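(* Let $s\in(0,1)$, let $r_k^*$ be the best uniform rational approximation of degree at most $k$ to $z^{-s}$ on $\Lambda=[\lambda_1,\lambda_n]$, let $d_1,\dots,d_k$ be its poles, and put $d_0=-\infty$. Let $\mathbf u_{k+1}=W f(W^TLW)W^T\mathbf b$ with $f(z)=z^{-s}$ be the rational Krylov approximation of $L^{-s}\mathbf b$ with poles $(d_j)_{j=0}^k$. Then $$\|L^{-s}\mathbf b-\mathbf u_{k+1}\|\le 2\,C\,C_s\,\lambda_1^{-s}\exp\bigl(-2\pi\sqrt{ks}\bigr)\,\|\mathbf b\|,$$ where $C_s>0$ is a constant which depends on $s$ and $C$ is the constant of the quasi-optimality bound for rational Krylov approximations recalled in the context ($C\le 11.08$, and $C=1$ if $L$ is self-adjoint).
   Context: $L=M^{-1}K\in\mathbb{R}^{n\times n}$, where $K$ and $M$ are the symmetric positive definite stiffness and mass matrices of a finite-dimensional discretization of a self-adjoint elliptic diffusion operator with homogeneous Dirichlet conditions; $\lambda_1>0$ and $\lambda_n$ are the smallest and largest eigenvalues of $L$, and $\mathbf b\in\mathbb{R}^n$. $\|\cdot\|$ is the Euclidean vector norm, the superscript $T$ is the ordinary transpose, and orthonormality is Euclidean. $\mathcal P_k$ is the space of polynomials of degree at most $k$. The best uniform rational approximation $r_k^*$ is the unique function of the form $p/q$ with $p,q\in\mathcal P_k$ that minimizes $\|z^{-s}-p(z)/q(z)\|_{L_\infty(\Lambda)}$. Poles are taken to be real, nonpositive and pairwise distinct. The constant $C_s$ is the one in Stahl's estimate $\|z^s-\tilde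 r_k^*(z)\|_{L_\infty[0,1]}\le C_s\exp(-2\pi\sqrt{ks})$ for the best rational approximation $\tilde r_k^*$ of degree at most $k$ to $z^s$ on $[0,1]$. Rational Krylov space: for poles $(d_j)_{j=0}^k\subset(-\infty,0]\cup\{-\infty\}$ put $q_k(z)=\prod_{0\le j\le k,\ d_j\neq-\infty}(z-d_j)$ and $\mathcal Q_{k+1}(L,\mathbf b)=q_k(L)^{-1}\operatorname{span}\{\mathbf b,L\mathbf b,\dots,L^k\mathbf b\}$; $W\in\mathbb{R}^{n\times(k+1)}$ is a matrix whose columns form an orthonormal basis of $\mathcal Q_{k+1}(L,\mathbf b)$. The constant $C$: the quasi-optimality bound says that for every function $g$ analytic in a neighbourhood of the numerical range $\mathbb W(L)$ and every set $\Sigma\supseteq\mathbb W(L)$, $$\|g(L)\mathbf b-W g(W^TLW)W^T\mathbf b\|\le 2C\|\mathbf b\|\min_{p\in\mathcal P_k}\|g-p/q_k\|_{L_\infty(\Sigma)}$$ with a constant $C\le 11.08$, and with $C=1$ if $L$ is self-adjoint.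
   Formalization: The formal theorem adds that the numerical range of L lies in [λ_1, λ_n], which forces L to be symmetric (so C = 1 suffices); without it the bound fails, e.g. L = [[1,t],[0,2]], b = e_2, k = 0, t large. *)

theory Defs
  imports "HOL-Complex_Analysis.Complex_Analysis"
begin

section \<open>Matrices, polynomials of matrices and functions of matrices\<close>

definition cmat :: "real^'n^'m \<Rightarrow> complex^'n^'m" where
  "cmat A = map_matrix complex_of_real A"

definition cvec :: "real^'n \<Rightarrow> complex^'n" where
  "cvec v = (\<chi> i. complex_of_real (v $ i))"

abbreviation cpoly :: "real poly \<Rightarrow> complex poly" where
  "cpoly p \<equiv> map_poly complex_of_real p"

definition pos_def :: "real^'n^'n \<Rightarrow> bool" where
  "pos_def A \<longleftrightarrow> transpose A = A \<and> (\<forall>x. x \<noteq> 0 \<longrightarrow> 0 < x \<bullet> (A *v x))"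

definition eigenvalues :: "'a::field^'n^'n \<Rightarrow> 'a set" where
  "eigenvalues A = {\<mu>. \<exists>v. v \<noteq> 0 \<and> A *v v = \<mu> *s v}"

definition numerical_range :: "complex^'n^'n \<Rightarrow> complex set" where
  "numerical_range A =
     {\<Sum>i\<in>UNIV. cnj (x $ i) * (A *v x) $ i | x. norm x = 1}"

text \<open>The operations \<open>*\<close> and \<open>^\<close> of the type of vectors act componentwise, so powers
  with respect to the matrix product are spelled out.\<close>

definition mat_pow :: "'a::field^'n^'n \<Rightarrow> nat \<Rightarrow> 'a^'n^'n" where
  "mat_pow A i = ((\<lambda>B. A ** B) ^^ i) (mat 1)"

definition mat_poly :: "'a::field poly \<Rightarrow> 'a^'n^'n \<Rightarrow> 'a^'n^'n" where
  "mat_poly p A = (\<Sum>i\<le>degree p. mat (coeff p i) ** mat_pow A i)"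

text \<open>The primary matrix function \<open>g(A)\<close>, through Hermite interpolation of \<open>g\<close> at the
  eigenvalues of \<open>A\<close>. Derivatives are matched up to an order that is at least the index of every
  eigenvalue; such polynomials exist, and they all take the same value at \<open>A\<close>.\<close>

definition mat_fun :: "(complex \<Rightarrow> complex) \<Rightarrow> complex^'n^'n \<Rightarrow> complex^'n^'n" where
  "mat_fun g A = mat_poly
     (SOME p. \<forall>\<mu>\<in>eigenvalues A. \<forall>j<CARD('n). (deriv ^^ j) (poly p) \<mu> = (deriv ^^ j) g \<mu>) A"


section \<open>Best uniform rational approximation\<close>

definition sup_norm_on :: "'a set \<Rightarrow> ('a \<Rightarrow> 'b::real_normed_vector) \<Rightarrow> ennreal" where
  "sup_norm_on S h = (SUP z\<in>S. ennreal (norm (h z)))"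

text \<open>A rational function that is bounded on \<open>S\<close> has, in lowest terms, no pole in \<open>S\<close>, so only
  denominators without zeros in \<open>S\<close> are admitted.\<close>

definition rational_on :: "nat \<Rightarrow> real set \<Rightarrow> real poly \<Rightarrow> real poly \<Rightarrow> bool" where
  "rational_on k S p q \<longleftrightarrow> degree p \<le> k \<and> degree q \<le> k \<and> (\<forall>z\<in>S. poly q z \<noteq> 0)"

definition best_rational_approx ::
  "nat \<Rightarrow> (real \<Rightarrow> real) \<Rightarrow> real set \<Rightarrow> real poly \<Rightarrow> real poly \<Rightarrow> bool" where
  "best_rational_approx k f S p q \<longleftrightarrow>
     rational_on k S p q \<and>
     (\<forall>p' q'. rational_on k S p' q' \<longrightarrow>
        sup_norm_on S (\<lambda>z. f z - poly p z / poly q z)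
          \<le> sup_norm_on S (\<lambda>z. f z - poly p' z / poly q' z))"

definition rational_poles :: "real poly \<Rightarrow> real poly \<Rightarrow> complex set" where
  "rational_poles p q = {z. is_pole (\<lambda>w. poly (cpoly p) w / poly (cpoly q) w) z}"

text \<open>\<open>C\<close> is a valid constant in Stahl's estimate for the best approximations of \<open>z\<^sup>s\<close> on
  \<open>[0,1]\<close>, for all degrees simultaneously.\<close>

definition stahl_constant :: "real \<Rightarrow> real \<Rightarrow> bool" where
  "stahl_constant s C \<longleftrightarrow> 0 < C \<and>
     (\<forall>k. \<exists>p q. best_rational_approx k (\<lambda>z. z powr s) {0..1} p q \<and>
        sup_norm_on {0..1} (\<lambda>z. z powr s - poly p z / poly q z)
          \<le> ennreal (C * exp (- 2 * pi * sqrt (real k * s))))"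


section \<open>Rational Krylov spaces\<close>

definition pole_poly :: "nat \<Rightarrow> (nat \<Rightarrow> ereal) \<Rightarrow> real poly" where
  "pole_poly k d = (\<Prod>j\<in>{j. j \<le> k \<and> d j \<noteq> -\<infinity>}. [:- real_of_ereal (d j), 1:])"

definition rational_krylov ::
  "nat \<Rightarrow> (nat \<Rightarrow> ereal) \<Rightarrow> real^'n^'n \<Rightarrow> real^'n \<Rightarrow> (real^'n) set" where
  "rational_krylov k d L b =
     (\<lambda>v. matrix_inv (mat_poly (pole_poly k d) L) *v v) ` span ((\<lambda>i. mat_pow L i *v b) ` {..k})"

definition orthonormal_basis_matrix :: "real^'m^'n \<Rightarrow> (real^'n) set \<Rightarrow> bool" where
  "orthonormal_basis_matrix W Q \<longleftrightarrow> transpose W ** W = mat 1 \<and> span (columns W) = Q"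

definition krylov_approx ::
  "(complex \<Rightarrow> complex) \<Rightarrow> real^'n^'n \<Rightarrow> real^'n \<Rightarrow> real^'m^'n \<Rightarrow> complex^'n" where
  "krylov_approx g L b W =
     cmat W *v (mat_fun g (cmat (transpose W ** L ** W)) *v cvec (transpose W *v b))"

definition krylov_error ::
  "(complex \<Rightarrow> complex) \<Rightarrow> real^'n^'n \<Rightarrow> real^'n \<Rightarrow> real^'m^'n \<Rightarrow> real" where
  "krylov_error g L b W = norm (mat_fun g (cmat L) *v cvec b - krylov_approx g L b W)"

text \<open>\<open>C\<close> is a valid constant in the quasi-optimality bound for the given data. Zeros of
  \<open>q\<^sub>k\<close> in \<open>\<Sigma>\<close>, where the quotient below is \<open>0\<close> by convention, do no harm as long as
  none of them lies in the numerical range: further points of \<open>\<Sigma>\<close> only increase the right-hand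
  side.\<close>

definition quasi_optimality_constant ::
  "nat \<Rightarrow> (nat \<Rightarrow> ereal) \<Rightarrow> real^'n^'n \<Rightarrow> real^'n \<Rightarrow> real^'m^'n \<Rightarrow> real \<Rightarrow> bool" where
  "quasi_optimality_constant k d L b W C \<longleftrightarrow> 0 \<le> C \<and>
     (\<forall>g \<Sigma>. g analytic_on numerical_range (cmat L) \<and> numerical_range (cmat L) \<subseteq> \<Sigma> \<longrightarrow>
        ennreal (krylov_error g L b W)
          \<le> ennreal (2 * C * norm b) *
            (INF p\<in>{p. degree p \<le> k}.
               sup_norm_on \<Sigma> (\<lambda>z. g z - poly p z / poly (cpoly (pole_poly k d)) z)))"

end

(* The numerical range of L lies in a real interval, so L is symmetric and C = 1 is
   attainable by diagonalisation. With w = q_k(L)^-1 b, the Galerkin approximation reproduces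
   p(L) w exactly for every p of degree at most k, so the error is the difference of
   (g - p/q_k)(L) b and W (g - p/q_k)(W^T L W) W^T b, each bounded by the supremum of
   |g - p/q_k| times |b|.

   For the rate: k distinct poles force q to be a multiple of q_k, so r_k^* is an admissible
   p/q_k, and z -> lambda_1/z turns Stahl's approximations of z^s on [0,1] into
   approximations of z^-s on [lambda_1, lambda_n] at the cost of a factor lambda_1^-s. *)

theory Submission
  imports Defs
begin

text \<open>No quotient of matrices is ever estimated. If \<open>q_k(L) w = b\<close>, then
  \<open>(g - p/q_k)(L) b\<close> is \<open>(G q_k - p)(L) w\<close>, where \<open>G\<close> is the
  polynomial behind \<open>mat_fun\<close>, and its norm is compared with that of
  \<open>q_k(L) w\<close> one eigenvalue at a time. For the projected matrix \<open>H\<close> the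
  same argument needs \<open>q_k(H)\<close> to send \<open>W^T w\<close> to \<open>W^T b\<close>;
  since \<open>q_k\<close> may have degree k + 1, this asks for one degree more than the Krylov
  space itself contains. One supremum serves both matrices because the eigenvalues of
  \<open>H\<close> are Rayleigh quotients of \<open>L\<close>. Two features of the definitions shape
  the rest. \<open>mat_fun\<close> picks an interpolant by choice, so nothing is known about it
  before Hermite interpolants have been constructed. And \<open>g\<close> is complex while
  \<open>L\<close> is real, so a real eigenbasis has to serve complex vectors.\<close>

section \<open>Spectral theorem for self-adjoint maps\<close>

text \<open>For small \<open>t\<close> the linear term dominates and changes sign with
  \<open>t\<close>. This is the first-order condition at a maximiser, without calculus.\<close>

lemma quadratic_nonneg_linear_coeff_zero:
  fixes a c :: real
  assumes "\<And>t. 0 \<le> t * a + t\<^sup>2 * c"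
  shows "a = 0"
proof (rule ccontr)
  assume "a \<noteq> 0"
  \<comment> \<open>At \<open>t = - (e * a)\<close> the expression equals
    \<open>e * a^2 * (e * c - 1)\<close>; this \<open>e\<close> is small enough to make the last
    factor negative.\<close>
  define e where "e = 1 / (\<bar>c\<bar> + 1)"
  have e: "e > 0" "e * \<bar>c\<bar> < 1"
    by (auto simp: e_def field_simps)
  have "0 \<le> (- (e * a)) * a + (- (e * a))\<^sup>2 * c"
    by (rule assms)
  also have "\<dots> = e * a\<^sup>2 * (e * c - 1)"
    by (simp add: power2_eq_square algebra_simps)
  finally have "0 \<le> e * c - 1"
    using mult_pos_neg[of "e * a\<^sup>2" "e * c - 1"] e(1) \<open>a \<noteq> 0\<close> by force
  moreover have "e * c \<le> e * \<bar>c\<bar>"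
    using e(1) by simp
  ultimately show False
    using e(2) by linarith
qed

text \<open>A maximiser of the quadratic form on the unit sphere of \<open>S\<close> is an eigenvector.\<close>

lemma self_adjoint_eigenvector_in_subspace:
  fixes f :: "'a::euclidean_space \<Rightarrow> 'a"
  assumes f: "linear f" and sa: "\<And>x y. f x \<bullet> y = x \<bullet> f y"
    and S: "subspace S" and inv: "\<And>x. x \<in> S \<Longrightarrow> f x \<in> S" and "S \<noteq> {0}"
  obtains u m where "u \<in> S" "norm u = 1" "f u = m *\<^sub>R u"
proof -
  obtain y where y: "y \<in> S" "y \<noteq> 0"
    using \<open>S \<noteq> {0}\<close> subspace_0[OF S] by blast
  let ?T = "S \<inter> sphere 0 1"
  have "(1 / norm y) *\<^sub>R y \<in> ?T"
    using y S by (auto simp: subspace_scale)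
  hence "?T \<noteq> {}" by blast
  moreover have "compact ?T"
    using closed_subspace[OF S] by (simp add: closed_Int_compact)
  moreover have "continuous_on ?T (\<lambda>x. x \<bullet> f x)"
    using linear_continuous_on[of f] f
    by (intro continuous_intros) (simp add: linear_conv_bounded_linear)
  ultimately obtain u where u: "u \<in> ?T" and max: "\<And>x. x \<in> ?T \<Longrightarrow> x \<bullet> f x \<le> u \<bullet> f u"
    using continuous_attains_sup[of ?T "\<lambda>x. x \<bullet> f x"] by metis
  define m where "m = u \<bullet> f u"
  have uu: "u \<bullet> u = 1"
    using u by (simp add: dot_square_norm)
  have form: "x \<bullet> f x \<le> m * (x \<bullet> x)" if "x \<in> S" for x
  proof (cases "x = 0")
    case False
    have "(1 / norm x) *\<^sub>R x \<in> ?T"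
      using that False S by (auto simp: subspace_scale)
    from max[OF this] have "(x \<bullet> f x) / (norm x)\<^sup>2 \<le> m"
      by (simp add: linear_scale[OF f] m_def power2_eq_square)
    thus ?thesis
      using False by (simp add: field_simps dot_square_norm)
  qed simp
  \<comment> \<open>The residual of the eigenvalue equation. Moving \<open>u\<close> in this
    direction makes the first-order coefficient \<open>2 * (v \<bullet> v)\<close>, which therefore
    has to vanish.\<close>
  define v where "v = m *\<^sub>R u - f u"
  have v: "v \<in> S"
    using u inv S by (auto simp: v_def intro: subspace_diff subspace_scale)
  have "2 * (v \<bullet> v) = 0"
  proof (rule quadratic_nonneg_linear_coeff_zero)
    fix t :: real
    have "u + t *\<^sub>R v \<in> S"
      using u v S by (auto intro: subspace_add subspace_scale)
    from form[OF this]
    have "0 \<le> m * ((u + t *\<^sub>R v) \<bullet> (u + t *\<^sub>R v)) - (u + t *\<^sub>R v) \<bullet> f (u + t *\<^sub>R v)"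
      by simp
    also have "f (u + t *\<^sub>R v) = f u + t *\<^sub>R f v"
      by (simp add: linear_add[OF f] linear_scale[OF f])
    also have "m * ((u + t *\<^sub>R v) \<bullet> (u + t *\<^sub>R v)) - (u + t *\<^sub>R v) \<bullet> (f u + t *\<^sub>R f v) =
        t * (2 * (m * (u \<bullet> v) - f u \<bullet> v)) + t\<^sup>2 * (m * (v \<bullet> v) - v \<bullet> f v)"
      using sa[of u v]
      by (simp add: inner_simps uu m_def[symmetric] power2_eq_square inner_commute algebra_simps)
    also have "m * (u \<bullet> v) - f u \<bullet> v = v \<bullet> v"
      by (simp add: v_def inner_simps inner_commute algebra_simps)
    finally show "0 \<le> t * (2 * (v \<bullet> v)) + t\<^sup>2 * (m * (v \<bullet> v) - v \<bullet> f v)" .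
  qed
  hence "f u = m *\<^sub>R u"
    by (simp add: v_def)
  with u show ?thesis
    using that by auto
qed

text \<open>Take a largest orthogonal set of nonzero eigenvectors. Self-adjointness makes its
  orthogonal complement invariant, so a nonzero complement would supply one more
  eigenvector.\<close>

lemma self_adjoint_orthogonal_eigenbasis:
  fixes f :: "'a::euclidean_space \<Rightarrow> 'a"
  assumes f: "linear f" and sa: "\<And>x y. f x \<bullet> y = x \<bullet> f y"
  obtains B \<mu> where "finite B" "pairwise orthogonal B" "0 \<notin> B" "span B = UNIV"
    "\<And>v. v \<in> B \<Longrightarrow> f v = \<mu> v *\<^sub>R v"
proof -
  define P where "P B \<longleftrightarrow> pairwise orthogonal B \<and> 0 \<notin> B \<and> (\<forall>v\<in>B. \<exists>m. f v = m *\<^sub>R v)" for B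
  have bound: "finite B \<and> card B \<le> DIM('a)" if "P B" for B
  proof -
    have "independent B"
      using that pairwise_orthogonal_independent by (auto simp: P_def)
    thus ?thesis
      using independent_bound by auto
  qed
  have "P {}" by (simp add: P_def)
  then obtain B where B: "P B" and max: "\<And>B'. P B' \<Longrightarrow> card B' \<le> card B"
    using ex_has_greatest_nat[of P "{}" card "Suc DIM('a)"] bound by (metis le_imp_less_Suc)
  let ?S = "{x. \<forall>v\<in>B. orthogonal v x}"
  have "?S = {0}"
  proof (rule ccontr)
    assume "?S \<noteq> {0}"
    moreover have "subspace ?S"
      by (auto simp: subspace_def orthogonal_clauses)
    moreover have "f x \<in> ?S" if "x \<in> ?S" for x
    proof safe
      fix v assume v: "v \<in> B"
      then obtain m where "f v = m *\<^sub>R v"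
        using B by (auto simp: P_def)
      thus "orthogonal v (f x)"
        using that v by (simp add: orthogonal_def sa[symmetric])
    qed
    ultimately obtain u m where u: "u \<in> ?S" "norm u = 1" "f u = m *\<^sub>R u"
      using self_adjoint_eigenvector_in_subspace[OF f sa] by blast
    have "u \<notin> B"
      using u by (auto simp: orthogonal_def)
    moreover have "P (insert u B)"
      using B u by (auto simp: P_def pairwise_insert orthogonal_commute)
    ultimately show False
      using max[of "insert u B"] bound[OF B] by simp
  qed
  have "span B = UNIV"
  proof (rule ccontr)
    assume "span B \<noteq> UNIV"
    then obtain a where "a \<noteq> 0" "\<forall>x \<in> span B. a \<bullet> x = 0"
      using span_not_UNIV_orthogonal by blast
    thus False
      using \<open>?S = {0}\<close> by (auto simp: orthogonal_def inner_commute span_base)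
  qed
  moreover obtain \<mu> where "\<And>v. v \<in> B \<Longrightarrow> f v = \<mu> v *\<^sub>R v"
    using B unfolding P_def by metis
  ultimately show ?thesis
    using that B bound by (auto simp: P_def)
qed

section \<open>Hermite interpolation\<close>

lemma higher_deriv_poly: "(deriv ^^ j) (poly p) = poly ((pderiv ^^ j) p)"
  for p :: "complex poly"
proof (induction j)
  case (Suc j)
  have "deriv (poly r) = poly (pderiv r)" for r :: "complex poly"
    by (rule ext, rule DERIV_imp_deriv, rule poly_DERIV)
  thus ?case using Suc by simp
qed simp

text \<open>One derivative lowers the exponent from \<open>Suc m\<close> to \<open>m\<close> and
  replaces the cofactor \<open>r\<close> by \<open>(m + 1) * r\<close> plus a multiple of the linear
  factor. That multiple vanishes at \<open>a\<close>, so only the factorial accumulates.\<close>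

lemma poly_higher_pderiv_root_power:
  fixes a :: "'a::{comm_ring_1,ring_no_zero_divisors,semiring_char_0}"
  shows "j \<le> m \<Longrightarrow>
    poly ((pderiv ^^ j) ([:- a, 1:] ^ m * r)) a = (if j = m then fact m * poly r a else 0)"
proof (induction m arbitrary: j r)
  case (Suc m)
  show ?case
  proof (cases j)
    case (Suc i)
    have "pderiv ([:- a, 1:] ^ Suc m * r) =
        [:- a, 1:] ^ m * (smult (of_nat (Suc m)) r + [:- a, 1:] * pderiv r)"
      by (simp only: pderiv_mult pderiv_power_Suc)
        (simp add: pderiv_pCons algebra_simps)
    thus ?thesis
      using Suc Suc.IH[of i "smult (of_nat (Suc m)) r + [:- a, 1:] * pderiv r"] Suc.prems
      by (simp only: funpow_Suc_right o_def) (auto simp: algebra_simps)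
  qed simp
qed simp

lemma higher_pderiv_add: "(pderiv ^^ j) (p + r) = (pderiv ^^ j) p + (pderiv ^^ j) r"
  by (induction j) (auto simp: pderiv_add)

lemma higher_pderiv_smult: "(pderiv ^^ j) (smult c r) = smult c ((pderiv ^^ j) r)"
  by (induction j) (auto simp: pderiv_smult)

text \<open>Newton's scheme: nodes are added one by one, and at a new node \<open>a\<close> the
  derivatives are corrected in increasing order. The correction is a multiple of
  \<open>(X - a)^m * P\<close>, where \<open>P\<close> vanishes to order \<open>N\<close> at the old
  nodes, so everything already matched stays matched.\<close>

lemma hermite_interpolation:
  fixes c :: "'a::{field_char_0} \<Rightarrow> nat \<Rightarrow> 'a"
  assumes "finite S"
  obtains p where "\<And>x j. x \<in> S \<Longrightarrow> j < N \<Longrightarrow> poly ((pderiv ^^ j) p) x = c x j"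
proof -
  have "\<exists>p. \<forall>x\<in>S. \<forall>j<N. poly ((pderiv ^^ j) p) x = c x j"
    using assms
  proof (induction S)
    case (insert a S)
    then obtain p where p: "\<forall>x\<in>S. \<forall>j<N. poly ((pderiv ^^ j) p) x = c x j"
      by blast
    define P where "P = (\<Prod>x\<in>S. [:- x, 1:] ^ N)"
    have Pa: "poly P a \<noteq> 0"
      using insert.hyps by (auto simp: P_def poly_prod)
    have "\<exists>p. (\<forall>x\<in>S. \<forall>j<N. poly ((pderiv ^^ j) p) x = c x j) \<and>
        (\<forall>j<m. poly ((pderiv ^^ j) p) a = c a j)" for m
    proof (induction m)
      case 0
      show ?case using p by blast
    next
      case (Suc m)
      then obtain p where p: "\<forall>x\<in>S. \<forall>j<N. poly ((pderiv ^^ j) p) x = c x j"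
        and pa: "\<forall>j<m. poly ((pderiv ^^ j) p) a = c a j" by blast
      \<comment> \<open>The \<open>m\<close>-th derivative of \<open>(X - a)^m * P\<close> at
        \<open>a\<close> is \<open>fact m * poly P a\<close>, so this \<open>t\<close> removes the
        remaining defect.\<close>
      define t where "t = (c a m - poly ((pderiv ^^ m) p) a) / (fact m * poly P a)"
      define r where "r = p + smult t ([:- a, 1:] ^ m * P)"
      have "poly ((pderiv ^^ j) r) a = c a j" if "j < Suc m" for j
        using that pa Pa poly_higher_pderiv_root_power[of j m a P]
        by (cases "j = m") (auto simp: r_def higher_pderiv_add higher_pderiv_smult t_def)
      moreover have "poly ((pderiv ^^ j) r) x = c x j" if "x \<in> S" "j < N" for x j
      proof -
        have "[:- a, 1:] ^ m * P = [:- x, 1:] ^ N * ([:- a, 1:] ^ m * (\<Prod>y\<in>S-{x}. [:- y, 1:] ^ N))"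
          using that insert.hyps by (simp add: P_def prod.remove[of S x] mult_ac)
        hence "poly ((pderiv ^^ j) ([:- a, 1:] ^ m * P)) x = 0"
          using poly_higher_pderiv_root_power[of j N x] that(2)
          by (simp only: if_False order.strict_implies_order order.strict_implies_not_eq)
        thus ?thesis
          using p that by (simp add: r_def higher_pderiv_add higher_pderiv_smult)
      qed
      ultimately show ?case by blast
    qed
    from this[of N] show ?case by auto
  qed auto
  thus ?thesis using that by blast
qed

section \<open>Polynomials and functions of symmetric matrices\<close>

lemma cvec_simps:
  "cvec 0 = 0" "cvec (x + y) = cvec x + cvec y" "cvec (a *s x) = complex_of_real a *s cvec x"
  "cvec x = cvec y \<longleftrightarrow> x = y"
  by (auto simp: cvec_def vec_eq_iff)

lemma cvec_sum: "cvec (\<Sum>v\<in>B. f v) = (\<Sum>v\<in>B. cvec (f v))"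
  by (simp add: cvec_def vec_eq_iff)

lemma cmat_mult_cvec: "cmat A *v cvec x = cvec (A *v x)"
  by (simp add: cmat_def cvec_def vec_eq_iff matrix_vector_mult_def map_matrix_def)

lemma cmat_mult: "cmat (A ** B) = cmat A ** cmat B"
  by (simp add: cmat_def map_matrix_def vec_eq_iff matrix_matrix_mult_def)

lemma mat_scalar_vector_mult: "mat c *v x = c *s x" for x :: "'a::comm_semiring_1^'n"
  by (simp add: matrix_vector_mult_def mat_def vec_eq_iff if_distrib if_distribR cong: if_cong)

lemma sum_matrix_vector_mult: "(\<Sum>i\<in>I. F i) *v x = (\<Sum>i\<in>I. F i *v x)"
  by (induction I rule: infinite_finite_induct) (auto simp: matrix_vector_mult_add_rdistrib)

lemma matrix_vector_mult_sum:
  fixes A :: "'a::field^'n^'m"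
  shows "A *v (\<Sum>i\<in>I. f i) = (\<Sum>i\<in>I. A *v f i)"
  by (induction I rule: infinite_finite_induct) (auto simp: matrix_vector_right_distrib)

lemma mat_pow_Suc_vector: "mat_pow A (Suc i) *v x = A *v (mat_pow A i *v x)"
  by (simp add: mat_pow_def matrix_vector_mul_assoc)

text \<open>An upper bound \<open>N\<close> in place of the exact degree allows \<open>pCons\<close>
  to be expanded without separating the zero polynomial.\<close>

lemma mat_poly_vector:
  assumes "degree p \<le> N"
  shows "mat_poly p A *v x = (\<Sum>i\<le>N. coeff p i *s (mat_pow A i *v x))"
proof -
  have "mat_poly p A *v x = (\<Sum>i\<le>degree p. coeff p i *s (mat_pow A i *v x))"
    by (simp add: mat_poly_def sum_matrix_vector_mult mat_scalar_vector_mult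
        matrix_vector_mul_assoc[symmetric])
  also have "\<dots> = (\<Sum>i\<le>N. coeff p i *s (mat_pow A i *v x))"
    using assms by (intro sum.mono_neutral_left) (auto simp: not_le coeff_eq_0)
  finally show ?thesis .
qed

lemma mat_poly_0_vector: "mat_poly 0 A *v x = 0"
  by (simp add: mat_poly_vector[of _ 0])

text \<open>Horner's rule. It reduces the algebra of matrix polynomials, stated through their action
  on a vector, to inductions on the polynomial.\<close>

lemma mat_poly_pCons_vector:
  "mat_poly (pCons a p) A *v x = a *s x + A *v (mat_poly p A *v x)"
proof -
  have "mat_poly (pCons a p) A *v x =
      (\<Sum>i\<le>Suc (degree p). coeff (pCons a p) i *s (mat_pow A i *v x))"
    by (rule mat_poly_vector) (rule degree_pCons_le)
  also have "\<dots> = a *s (mat_pow A 0 *v x) + (\<Sum>i\<le>degree p. coeff p i *s (mat_pow A (Suc i) *v x))"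
    by (subst sum.atMost_Suc_shift) simp
  also have "\<dots> = a *s x + A *v (mat_poly p A *v x)"
    by (simp add: mat_poly_vector[of p "degree p"] matrix_vector_mult_sum mat_pow_Suc_vector
        vector_scalar_commute)
      (simp add: mat_pow_def)
  finally show ?thesis .
qed

lemma mat_poly_add_vector: "mat_poly (p + r) A *v x = mat_poly p A *v x + mat_poly r A *v x"
  by (induction p r rule: poly_induct2)
    (simp_all add: mat_poly_0_vector mat_poly_pCons_vector matrix_vector_right_distrib
      vector_sadd_rdistrib)

lemma mat_poly_smult_vector: "mat_poly (smult c p) A *v x = c *s (mat_poly p A *v x)"
  by (induction p)
    (simp_all add: mat_poly_0_vector mat_poly_pCons_vector vector_scalar_commute
      vector_add_ldistrib)

lemma mat_poly_diff_vector: "mat_poly (p - r) A *v x = mat_poly p A *v x - mat_poly r A *v x"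
  using mat_poly_add_vector[of "p - r" r A x] by simp

lemma mat_poly_mult_vector: "mat_poly (p * r) A *v x = mat_poly p A *v (mat_poly r A *v x)"
  by (induction p)
    (simp_all add: mat_poly_0_vector mat_poly_pCons_vector mat_poly_add_vector
      mat_poly_smult_vector)

lemma mat_poly_commute_mat_pow:
  "mat_poly p A *v (mat_pow A i *v x) = mat_pow A i *v (mat_poly p A *v x)"
proof (induction i arbitrary: x)
  case (Suc i)
  have "mat_poly p A *v (A *v y) = A *v (mat_poly p A *v y)" for y
    by (induction p)
      (simp_all add: mat_poly_0_vector mat_poly_pCons_vector matrix_vector_right_distrib
        vector_scalar_commute)
  thus ?case using Suc by (simp add: mat_pow_Suc_vector)
qed (simp add: mat_pow_def)

lemma mat_poly_eigenvector: "A *v v = \<mu> *s v \<Longrightarrow> mat_poly p A *v v = poly p \<mu> *s v"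
  by (induction p)
    (simp_all add: mat_poly_0_vector mat_poly_pCons_vector vector_scalar_commute
      mult_ac)

lemma cpoly_pCons: "cpoly (pCons a p) = pCons (complex_of_real a) (cpoly p)"
  by (simp add: map_poly_pCons)

lemma mat_poly_cmat_cvec: "mat_poly (cpoly p) (cmat A) *v cvec x = cvec (mat_poly p A *v x)"
  by (induction p)
    (simp_all add: mat_poly_0_vector mat_poly_pCons_vector cpoly_pCons cvec_simps
      cmat_mult_cvec)

text \<open>In a Horner step \<open>V U\<close> is applied only to \<open>p(A) w\<close> for the
  shorter polynomial \<open>p\<close>, and the outermost factor \<open>A\<close> comes after it.
  Hence exactness reaches degree \<open>Suc k\<close> although \<open>V U\<close> is known to fix
  vectors only up to degree \<open>k\<close>.\<close>

lemma mat_poly_compression: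
  fixes A :: "'a::field^'n^'n" and V :: "'a^'m^'n" and U :: "'a^'n^'m"
  assumes fixed: "\<And>p. degree p \<le> k \<Longrightarrow> V *v (U *v (mat_poly p A *v w)) = mat_poly p A *v w"
    and "degree p \<le> Suc k"
  shows "mat_poly p (U ** A ** V) *v (U *v w) = U *v (mat_poly p A *v w)"
  using assms(2)
proof (induction p)
  case (pCons a p)
  have deg: "degree p \<le> k"
    using pCons.prems by (cases "p = 0") (auto simp: degree_pCons_eq)
  thus ?case
    using pCons.IH fixed[OF deg]
    by (simp add: mat_poly_pCons_vector matrix_vector_right_distrib vector_scalar_commute
        matrix_vector_mul_assoc[symmetric])
qed (simp add: mat_poly_0_vector)

lemma complex_vector_decompose:
  "y = cvec (\<chi> i. Re (y $ i)) + \<i> *s cvec (\<chi> i. Im (y $ i))"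
  by (simp add: cvec_def vec_eq_iff complex_eq[symmetric])

text \<open>On complex vectors \<open>\<bullet>\<close> is the real inner product, and it factors
  here. Real orthogonal vectors thus stay orthogonal under complex scaling, which makes Pythagoras
  available for complex combinations.\<close>

lemma inner_scaled_cvec: "(a *s cvec x) \<bullet> (c *s cvec y) = (a \<bullet> c) * (x \<bullet> y)"
  by (simp add: inner_vec_def cvec_def sum_distrib_left inner_complex_def algebra_simps
      sum.distrib)

lemma norm_cvec: "norm (cvec x) = norm x"
  using inner_scaled_cvec[of 1 x 1 x] by (simp add: norm_eq_sqrt_inner)

lemma norm_scaled_cvec: "norm (a *s cvec x) = norm a * norm x"
  using inner_scaled_cvec[of a x a x]
  by (simp add: norm_eq_sqrt_inner real_sqrt_mult)

text \<open>Expanding real and imaginary parts separately shows that a real eigenbasis also spans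
  the complex space. The basis is orthogonal but not normalised, hence the factors
  \<open>norm v\<close> in the Parseval identity.\<close>

lemma symmetric_complex_eigenexpansion:
  fixes A :: "real^'n^'n"
  assumes "transpose A = A"
  obtains B :: "(real^'n) set" and \<mu> where "finite B"
    "\<And>v. v \<in> B \<Longrightarrow> v \<noteq> 0" "\<And>v. v \<in> B \<Longrightarrow> A *v v = \<mu> v *s v"
    "\<And>c. (norm (\<Sum>v\<in>B. c v *s cvec v))\<^sup>2 = (\<Sum>v\<in>B. (norm (c v) * norm v)\<^sup>2)"
    "\<And>y. \<exists>c. y = (\<Sum>v\<in>B. c v *s cvec v)"
proof -
  have "(A *v x) \<bullet> y = x \<bullet> (A *v y)" for x y
    using dot_lmul_matrix[of x A y] assms by (simp add: vector_transpose_matrix[symmetric])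
  then obtain B \<mu> where B: "finite B" "pairwise orthogonal B" "0 \<notin> B" "span B = UNIV"
    "\<And>v. v \<in> B \<Longrightarrow> A *v v = \<mu> v *\<^sub>R v"
    using self_adjoint_orthogonal_eigenbasis[OF matrix_vector_mul_linear[of A]] by metis
  show ?thesis
  proof
    show "finite B" by fact
    show "v \<noteq> 0" "A *v v = \<mu> v *s v" if "v \<in> B" for v
      using B that by (auto simp: scalar_mult_eq_scaleR)
    show "(norm (\<Sum>v\<in>B. c v *s cvec v))\<^sup>2 = (\<Sum>v\<in>B. (norm (c v) * norm v)\<^sup>2)" for c
    proof (subst norm_sum_Pythagorean)
      show "pairwise (\<lambda>i j. orthogonal (c i *s cvec i) (c j *s cvec j)) B"
        using B(2) by (auto simp: pairwise_def orthogonal_def inner_scaled_cvec)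
    qed (auto simp: B norm_scaled_cvec)
    have expand: "\<exists>c. x = (\<Sum>v\<in>B. c v *s v)" for x
      using span_finite[OF B(1)] B(4) by (auto simp: scalar_mult_eq_scaleR)
    show "\<exists>c. y = (\<Sum>v\<in>B. c v *s cvec v)" for y
    proof -
      obtain a where a: "(\<chi> i. Re (y $ i)) = (\<Sum>v\<in>B. a v *s v)"
        using expand by blast
      obtain b where b: "(\<chi> i. Im (y $ i)) = (\<Sum>v\<in>B. b v *s v)"
        using expand by blast
      have "y = cvec (\<chi> i. Re (y $ i)) + \<i> *s cvec (\<chi> i. Im (y $ i))"
        by (rule complex_vector_decompose)
      also have "\<dots> = (\<Sum>v\<in>B. (complex_of_real (a v) + \<i> * complex_of_real (b v)) *s cvec v)"
        unfolding a b
        by (simp add: cvec_sum cvec_simps vec.scale_sum_right sum.distrib vector_sadd_rdistrib)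
      finally show ?thesis
        by (rule exI[of _ "\<lambda>v. complex_of_real (a v) + \<i> * complex_of_real (b v)"])
    qed
  qed
qed

text \<open>Both polynomials act diagonally in the eigenbasis, so the bound holds coordinate by
  coordinate. It stands in for a norm bound on \<open>(P/R)(A)\<close> without inverting
  \<open>R(A)\<close>.\<close>

lemma symmetric_mat_poly_norm_le:
  fixes A :: "real^'n^'n" and y :: "complex^'n"
  assumes sym: "transpose A = A"
    and le: "\<And>\<mu>. \<mu> \<in> eigenvalues A \<Longrightarrow>
      norm (poly P (complex_of_real \<mu>)) \<le> E * norm (poly R (complex_of_real \<mu>))"
    and "0 \<le> E"
  shows "norm (mat_poly P (cmat A) *v y) \<le> E * norm (mat_poly R (cmat A) *v y)"
proof -
  from symmetric_complex_eigenexpansion[OF sym]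
  obtain B :: "(real^'n) set" and \<mu> where B: "finite B"
    "\<And>v. v \<in> B \<Longrightarrow> v \<noteq> 0" "\<And>v. v \<in> B \<Longrightarrow> A *v v = \<mu> v *s v"
    "\<And>c. (norm (\<Sum>v\<in>B. c v *s cvec v))\<^sup>2 = (\<Sum>v\<in>B. (norm (c v) * norm v)\<^sup>2)"
    "\<And>y. \<exists>c. y = (\<Sum>v\<in>B. c v *s cvec v)"
    by blast
  obtain c where c: "y = (\<Sum>v\<in>B. c v *s cvec v)"
    using B(5) by blast
  have diag: "mat_poly p (cmat A) *v y =
      (\<Sum>v\<in>B. (c v * poly p (complex_of_real (\<mu> v))) *s cvec v)" for p
  proof -
    have "mat_poly p (cmat A) *v cvec v = poly p (complex_of_real (\<mu> v)) *s cvec v"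
      if "v \<in> B" for v
      using that by (intro mat_poly_eigenvector) (simp add: cmat_mult_cvec B(3) cvec_simps)
    thus ?thesis
      by (simp add: c matrix_vector_mult_sum vector_scalar_commute)
  qed
  have "(norm (mat_poly P (cmat A) *v y))\<^sup>2 =
      (\<Sum>v\<in>B. (norm (c v * poly P (complex_of_real (\<mu> v))) * norm v)\<^sup>2)"
    unfolding diag by (rule B(4))
  also have "\<dots> \<le> (\<Sum>v\<in>B. (E * (norm (c v * poly R (complex_of_real (\<mu> v))) * norm v))\<^sup>2)"
  proof (intro sum_mono power_mono)
    fix v assume v: "v \<in> B"
    hence "\<mu> v \<in> eigenvalues A"
      using B by (auto simp: eigenvalues_def)
    from mult_left_mono[OF le[OF this], of "norm (c v) * norm v"]
    show "norm (c v * poly P (complex_of_real (\<mu> v))) * norm v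
        \<le> E * (norm (c v * poly R (complex_of_real (\<mu> v))) * norm v)"
      by (simp add: norm_mult mult_ac)
  qed auto
  also have "\<dots> = E\<^sup>2 * (norm (mat_poly R (cmat A) *v y))\<^sup>2"
    unfolding diag B(4) by (simp add: power_mult_distrib sum_distrib_left)
  also have "\<dots> = (E * norm (mat_poly R (cmat A) *v y))\<^sup>2"
    by (simp add: power_mult_distrib)
  finally show ?thesis
    using \<open>0 \<le> E\<close> by (simp add: power2_le_iff_abs_le)
qed

lemma symmetric_eigenvalues:
  fixes A :: "real^'n^'n"
  assumes "transpose A = A"
  shows "finite (eigenvalues (cmat A))" and "eigenvalues (cmat A) = complex_of_real ` eigenvalues A"
    and "finite (eigenvalues A)" and "eigenvalues A \<noteq> {}"
proof -
  from symmetric_complex_eigenexpansion[OF assms]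
  obtain B :: "(real^'n) set" and \<mu> where B: "finite B"
    "\<And>v. v \<in> B \<Longrightarrow> v \<noteq> 0" "\<And>v. v \<in> B \<Longrightarrow> A *v v = \<mu> v *s v"
    "\<And>c. (norm (\<Sum>v\<in>B. c v *s cvec v))\<^sup>2 = (\<Sum>v\<in>B. (norm (c v) * norm v)\<^sup>2)"
    "\<And>y. \<exists>c. y = (\<Sum>v\<in>B. c v *s cvec v)"
    by blast
  have \<mu>: "\<mu> ` B \<subseteq> eigenvalues A"
    using B by (auto simp: eigenvalues_def)
  have "B \<noteq> {}"
  proof
    assume "B = {}"
    \<comment> \<open>\<open>1\<close> is the all-ones vector, here merely some nonzero vector that
      an empty sum cannot represent.\<close>
    hence "(1 :: complex^'n) = 0" using B(5)[of 1] by simp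
    thus False by simp
  qed
  have real_to_complex: "complex_of_real ` eigenvalues A \<subseteq> eigenvalues (cmat A)"
  proof safe
    fix x assume "x \<in> eigenvalues A"
    then obtain v where "v \<noteq> 0" "A *v v = x *s v"
      by (auto simp: eigenvalues_def)
    thus "complex_of_real x \<in> eigenvalues (cmat A)"
      by (auto simp: eigenvalues_def cmat_mult_cvec cvec_simps
          simp flip: cvec_simps(1) intro!: exI[of _ "cvec v"])
  qed
  have sub: "eigenvalues (cmat A) \<subseteq> complex_of_real ` \<mu> ` B"
  proof
    fix z assume "z \<in> eigenvalues (cmat A)"
    then obtain y where y: "y \<noteq> 0" "cmat A *v y = z *s y"
      by (auto simp: eigenvalues_def)
    obtain c where c: "y = (\<Sum>v\<in>B. c v *s cvec v)"
      using B(5) by blast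
    have "cmat A *v y = (\<Sum>v\<in>B. (c v * complex_of_real (\<mu> v)) *s cvec v)"
      by (simp add: c matrix_vector_mult_sum vector_scalar_commute cmat_mult_cvec B(3) cvec_simps)
    moreover have "z *s y = (\<Sum>v\<in>B. (c v * z) *s cvec v)"
      by (simp add: c vec.scale_sum_right mult.commute)
    \<comment> \<open>In eigencoordinates the equation \<open>A y = z y\<close> says that every
      \<open>c v * (\<mu> v - z)\<close> vanishes; a nonzero \<open>c v\<close> then identifies
      \<open>z\<close> with \<open>\<mu> v\<close>.\<close>
    ultimately have "(\<Sum>v\<in>B. (c v * (complex_of_real (\<mu> v) - z)) *s cvec v) = 0"
      using y(2) by (simp add: right_diff_distrib vec.scale_left_diff_distrib sum_subtractf)
    hence "(\<Sum>v\<in>B. (norm (c v * (complex_of_real (\<mu> v) - z)) * norm v)\<^sup>2) = 0"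
      using B(4)[of "\<lambda>v. c v * (complex_of_real (\<mu> v) - z)"] by simp
    hence "c v * (complex_of_real (\<mu> v) - z) = 0" if "v \<in> B" for v
      using that B(1,2) by (subst (asm) sum_nonneg_eq_0_iff) auto
    moreover obtain v where "v \<in> B" "c v \<noteq> 0"
      using y(1) c by (metis (no_types, lifting) sum.neutral vec.scale_zero_left)
    ultimately show "z \<in> complex_of_real ` \<mu> ` B" by auto
  qed
  show "eigenvalues (cmat A) = complex_of_real ` eigenvalues A"
    using sub \<mu> real_to_complex by blast
  show "finite (eigenvalues (cmat A))"
    using sub B(1) finite_subset by blast
  have "eigenvalues A \<subseteq> \<mu> ` B"
    using sub real_to_complex by (auto dest!: subsetD)
  thus "finite (eigenvalues A)"
    using B(1) finite_subset by blast
  show "eigenvalues A \<noteq> {}"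
    using \<mu> \<open>B \<noteq> {}\<close> by blast
qed

text \<open>Hermite interpolation provides a witness for the choice in \<open>mat_fun\<close>. Of
  its conditions only the one with \<open>j = 0\<close> is kept: a symmetric matrix is
  diagonalisable, so values at the eigenvalues suffice.\<close>

lemma mat_fun_symmetric:
  fixes A :: "real^'n^'n"
  assumes "transpose A = A"
  obtains G where "mat_fun g (cmat A) = mat_poly G (cmat A)"
    "\<And>\<mu>. \<mu> \<in> eigenvalues A \<Longrightarrow> poly G (complex_of_real \<mu>) = g (complex_of_real \<mu>)"
proof -
  define G where "G = (SOME p. \<forall>\<mu>\<in>eigenvalues (cmat A). \<forall>j<CARD('n).
    (deriv ^^ j) (poly p) \<mu> = (deriv ^^ j) g \<mu>)"
  have "\<exists>p. \<forall>\<mu>\<in>eigenvalues (cmat A). \<forall>j<CARD('n). (deriv ^^ j) (poly p) \<mu> = (deriv ^^ j) g \<mu>"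
    using hermite_interpolation[OF symmetric_eigenvalues(1)[OF assms],
        of "CARD('n)" "\<lambda>\<mu> j. (deriv ^^ j) g \<mu>"]
    by (metis higher_deriv_poly)
  from someI_ex[OF this]
  have "\<forall>\<mu>\<in>eigenvalues (cmat A). \<forall>j<CARD('n). (deriv ^^ j) (poly G) \<mu> = (deriv ^^ j) g \<mu>"
    unfolding G_def .
  hence "\<forall>\<mu>\<in>eigenvalues (cmat A). poly G \<mu> = g \<mu>"
    using zero_less_card_finite[where 'a='n] by fastforce
  thus ?thesis
    using that[of G] symmetric_eigenvalues(2)[OF assms]
    by (auto simp: mat_fun_def G_def)
qed

text \<open>Read \<open>r(A) y\<close> as the data vector: the estimate then bounds
  \<open>(g - p/r)(A)\<close> on it. Multiplying by \<open>r\<close> on the spectrum turns the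
  function into the polynomial \<open>G * r - p\<close>.\<close>

lemma mat_fun_minus_rational_norm_le:
  fixes A :: "real^'n^'n" and y :: "complex^'n"
  assumes sym: "transpose A = A"
    and nz: "\<And>\<mu>. \<mu> \<in> eigenvalues A \<Longrightarrow> poly r (complex_of_real \<mu>) \<noteq> 0"
    and le: "\<And>\<mu>. \<mu> \<in> eigenvalues A \<Longrightarrow>
      norm (g (complex_of_real \<mu>) - poly p (complex_of_real \<mu>) / poly r (complex_of_real \<mu>)) \<le> E"
  shows "norm (mat_fun g (cmat A) *v (mat_poly r (cmat A) *v y) - mat_poly p (cmat A) *v y)
    \<le> E * norm (mat_poly r (cmat A) *v y)"
proof -
  obtain G where G: "mat_fun g (cmat A) = mat_poly G (cmat A)"
    "\<And>\<mu>. \<mu> \<in> eigenvalues A \<Longrightarrow> poly G (complex_of_real \<mu>) = g (complex_of_real \<mu>)"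
    using mat_fun_symmetric[OF sym] by blast
  obtain \<mu>0 where \<mu>0: "\<mu>0 \<in> eigenvalues A"
    using symmetric_eigenvalues(4)[OF sym] by blast
  have "0 \<le> E"
    using le[OF \<mu>0] norm_ge_zero order_trans by blast
  moreover have "norm (poly (G * r - p) (complex_of_real \<mu>)) \<le> E * norm (poly r (complex_of_real \<mu>))"
    if "\<mu> \<in> eigenvalues A" for \<mu>
  proof -
    let ?z = "complex_of_real \<mu>"
    have "poly (G * r - p) ?z = (g ?z - poly p ?z / poly r ?z) * poly r ?z"
      using nz[OF that] by (simp add: G(2)[OF that] field_simps)
    thus ?thesis
      using mult_right_mono[OF le[OF that], of "norm (poly r ?z)"] by (simp add: norm_mult)
  qed
  ultimately have "norm (mat_poly (G * r - p) (cmat A) *v y) \<le> E * norm (mat_poly r (cmat A) *v y)"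
    by (intro symmetric_mat_poly_norm_le[OF sym])
  thus ?thesis
    by (simp add: G(1) mat_poly_diff_vector mat_poly_mult_vector)
qed

lemma poly_cpoly_of_real: "poly (cpoly p) (complex_of_real x) = complex_of_real (poly p x)"
  by (induction p) (auto simp: cpoly_pCons)

lemma degree_cpoly: "degree (cpoly p) = degree p"
  by (rule degree_map_poly) simp

section \<open>Numerical range\<close>

lemma real_form_in_numerical_range:
  assumes "norm v = 1"
  shows "complex_of_real (v \<bullet> (A *v v)) \<in> numerical_range (cmat A)"
proof -
  have "complex_of_real (v \<bullet> (A *v v)) =
      (\<Sum>i\<in>UNIV. cnj (cvec v $ i) * (cmat A *v cvec v) $ i)"
    unfolding cmat_mult_cvec by (simp add: inner_vec_def cvec_def)
  thus ?thesis
    unfolding numerical_range_def using assms norm_cvec[of v] by (auto intro!: exI[of _ "cvec v"])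
qed

lemma inner_transpose_matrix: "(transpose A *v x) \<bullet> y = x \<bullet> (A *v y)"
  for A :: "real^'n^'m"
  by (simp add: transpose_matrix_vector dot_lmul_matrix)

lemma norm_isometry:
  fixes W :: "real^'m^'n"
  assumes "transpose W ** W = mat 1"
  shows "norm (W *v u) = norm u" and "norm (cmat W *v y) = norm y"
    and "norm (transpose W *v x) \<le> norm x"
proof -
  have "(W *v u) \<bullet> (W *v u) = u \<bullet> u" for u
    using inner_transpose_matrix[of W "W *v u" u] assms
    by (simp add: matrix_vector_mul_assoc)
  hence 1: "norm (W *v u) = norm u" for u
    by (simp add: norm_eq_sqrt_inner)
  thus "norm (W *v u) = norm u" .
  have split: "(norm (cvec a + \<i> *s cvec b))\<^sup>2 = (norm a)\<^sup>2 + (norm b)\<^sup>2" for a b :: "real^'k"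
    using norm_add_Pythagorean[of "cvec a" "\<i> *s cvec b"] inner_scaled_cvec[of 1 a \<i> b]
    by (simp add: orthogonal_def norm_scaled_cvec norm_cvec)
  obtain a b where y: "y = cvec a + \<i> *s cvec b"
    using complex_vector_decompose by blast
  have "cmat W *v y = cvec (W *v a) + \<i> *s cvec (W *v b)"
    by (simp add: y matrix_vector_right_distrib vector_scalar_commute cmat_mult_cvec)
  hence "(norm (cmat W *v y))\<^sup>2 = (norm y)\<^sup>2"
    by (simp add: split y 1)
  thus "norm (cmat W *v y) = norm y"
    by simp
  let ?t = "transpose W *v x"
  have "(norm ?t)\<^sup>2 = x \<bullet> (W *v ?t)"
    unfolding power2_norm_eq_inner by (rule inner_transpose_matrix)
  also have "\<dots> \<le> norm x * norm ?t"
    using norm_cauchy_schwarz[of x "W *v ?t"] by (simp add: 1)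
  finally show "norm ?t \<le> norm x"
    by (cases "?t = 0") (auto simp: power2_eq_square)
qed

text \<open>An eigenvalue of the compression is the Rayleigh quotient of \<open>A\<close> at
  \<open>W u / norm u\<close>. The choice \<open>W = mat 1\<close> covers the eigenvalues of
  \<open>A\<close> itself.\<close>

lemma eigenvalue_compression_in_numerical_range:
  fixes W :: "real^'m^'n"
  assumes iso: "transpose W ** W = mat 1" and "\<mu> \<in> eigenvalues (transpose W ** A ** W)"
  shows "complex_of_real \<mu> \<in> numerical_range (cmat A)"
proof -
  obtain u where u: "u \<noteq> 0" "(transpose W ** A ** W) *v u = \<mu> *s u"
    using assms(2) by (auto simp: eigenvalues_def)
  define v where "v = (1 / norm u) *s (W *v u)"
  have "norm v = 1"
    using u(1) by (simp add: v_def scalar_mult_eq_scaleR norm_isometry[OF iso])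
  moreover have "(W *v u) \<bullet> (A *v (W *v u)) = \<mu> * (norm u)\<^sup>2"
  proof -
    have "(W *v u) \<bullet> (A *v (W *v u)) = (transpose W *v (A *v (W *v u))) \<bullet> u"
      by (subst inner_transpose_matrix) (simp add: inner_commute)
    also have "transpose W *v (A *v (W *v u)) = \<mu> *s u"
      by (simp add: u(2)[symmetric] matrix_vector_mul_assoc matrix_mul_assoc)
    finally show ?thesis
      by (simp add: scalar_mult_eq_scaleR power2_norm_eq_inner)
  qed
  hence "v \<bullet> (A *v v) = \<mu>"
    using u(1)
    by (simp add: v_def scalar_mult_eq_scaleR matrix_vector_mult_scaleR power2_eq_square)
  ultimately show ?thesis
    using real_form_in_numerical_range[of v A] by simp
qed

text \<open>Polarisation: at \<open>u + \<i> v\<close> the imaginary part of the form is exactly the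
  asymmetry \<open>u \<bullet> A v - v \<bullet> A u\<close>.\<close>

lemma symmetric_if_numerical_range_real:
  fixes A :: "real^'n^'n"
  assumes "numerical_range (cmat A) \<subseteq> \<real>"
  shows "transpose A = A"
proof -
  have sym: "u \<bullet> (A *v v) = v \<bullet> (A *v u)" for u v
  proof -
    define x where "x = cvec u + \<i> *s cvec v"
    let ?S = "\<lambda>x. \<Sum>i\<in>UNIV. cnj (x $ i) * (cmat A *v x) $ i"
    have "?S x \<in> \<real>"
    proof (cases "x = 0")
      case False
      define r where "r = 1 / norm x"
      have "norm (complex_of_real r *s x) = 1"
        using False norm_scaleR[of r x]
        by (simp add: r_def scaleR_vec_def vector_scalar_mult_def scaleR_conv_of_real)
      hence "?S (complex_of_real r *s x) \<in> \<real>"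
        using assms by (auto simp: numerical_range_def)
      also have "?S (complex_of_real r *s x) = complex_of_real (r\<^sup>2) * ?S x"
        by (simp add: vector_scalar_commute sum_distrib_left power2_eq_square mult_ac)
      finally show ?thesis
        using False by (simp add: complex_is_Real_iff r_def)
    qed simp
    moreover have "Im (?S x) = u \<bullet> (A *v v) - v \<bullet> (A *v u)"
      by (simp add: x_def matrix_vector_right_distrib vector_scalar_commute cmat_mult_cvec)
        (simp add: cvec_def inner_vec_def sum_subtractf)
    ultimately show ?thesis
      by (simp add: complex_is_Real_iff)
  qed
  have "transpose A *v u = A *v u" for u
  proof -
    have "x \<bullet> (transpose A *v u) = x \<bullet> (A *v u)" for x
      by (subst inner_commute, subst inner_transpose_matrix) (rule sym)
    thus ?thesis using vector_eq_ldot by blast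
  qed
  thus ?thesis by (simp add: matrix_eq)
qed

lemma matrix_inv_inverse:
  assumes "invertible A"
  shows "A ** matrix_inv A = mat 1" and "matrix_inv A ** A = mat 1"
  using someI_ex[OF assms[unfolded invertible_def]] by (simp_all add: matrix_inv_def)

text \<open>An eigenvector solves the generalised problem \<open>K v = \<mu> M v\<close>, so
  \<open>\<mu>\<close> is a quotient of two positive quadratic forms.\<close>

lemma pos_def_pencil_eigenvalue_pos:
  assumes "pos_def K" "pos_def M" "\<mu> \<in> eigenvalues (matrix_inv M ** K)"
  shows "0 < \<mu>"
proof -
  obtain v where v: "v \<noteq> 0" "(matrix_inv M ** K) *v v = \<mu> *s v"
    using assms(3) by (auto simp: eigenvalues_def)
  have "M *v x = 0 \<longrightarrow> x = 0" for x
    using assms(2) unfolding pos_def_def by (metis inner_zero_right less_irrefl)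
  hence "invertible M"
    using matrix_left_invertible_ker[of M] by (simp add: invertible_left_inverse)
  hence "M *v ((matrix_inv M ** K) *v v) = K *v v"
    by (simp add: matrix_vector_mul_assoc matrix_mul_assoc matrix_inv_inverse(1))
  hence "K *v v = \<mu> *s (M *v v)"
    by (simp only: v(2) vector_scalar_commute)
  hence "v \<bullet> (K *v v) = \<mu> * (v \<bullet> (M *v v))"
    by (simp add: scalar_mult_eq_scaleR)
  moreover have "0 < v \<bullet> (K *v v)" "0 < v \<bullet> (M *v v)"
    using assms(1,2) v(1) by (auto simp: pos_def_def)
  ultimately show ?thesis
    by (simp add: zero_less_mult_iff)
qed

section \<open>Rational Krylov approximation\<close>

lemma degree_pole_poly_le: "degree (pole_poly k d) \<le> Suc k"
proof -
  have "degree (pole_poly k d) \<le> card {j. j \<le> k \<and> d j \<noteq> -\<infinity>}"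
    unfolding pole_poly_def
    using degree_prod_sum_le[of "{j. j \<le> k \<and> d j \<noteq> -\<infinity>}" "\<lambda>j. [:- real_of_ereal (d j), 1:]"]
    by (simp add: o_def)
  also have "\<dots> \<le> card {..k}"
    by (intro card_mono) auto
  finally show ?thesis by simp
qed

text \<open>Comparing the constant polynomial \<open>1\<close> with \<open>p\<close> bounds
  \<open>norm x\<close> by a multiple of \<open>norm (p(A) x)\<close>, so the kernel is trivial.
  Summing \<open>1 / \<bar>p \<mu>\<bar>\<close> over the finite spectrum gives a uniform
  constant.\<close>

lemma symmetric_mat_poly_invertible:
  fixes A :: "real^'n^'n"
  assumes sym: "transpose A = A" and nz: "\<And>\<mu>. \<mu> \<in> eigenvalues A \<Longrightarrow> poly p \<mu> \<noteq> 0"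
  shows "invertible (mat_poly p A)"
proof -
  define E where "E = (\<Sum>\<mu>\<in>eigenvalues A. 1 / \<bar>poly p \<mu>\<bar>)"
  note fin = symmetric_eigenvalues(3)[OF sym]
  have "x = 0" if "mat_poly p A *v x = 0" for x
  proof -
    have "norm (mat_poly 1 (cmat A) *v cvec x) \<le> E * norm (mat_poly (cpoly p) (cmat A) *v cvec x)"
    proof (rule symmetric_mat_poly_norm_le[OF sym])
      fix \<mu> assume \<mu>: "\<mu> \<in> eigenvalues A"
      have "1 / \<bar>poly p \<mu>\<bar> \<le> E"
        unfolding E_def using \<mu> fin by (intro member_le_sum) auto
      thus "norm (poly 1 (complex_of_real \<mu>)) \<le> E * norm (poly (cpoly p) (complex_of_real \<mu>))"
        using nz[OF \<mu>] by (simp add: poly_cpoly_of_real field_simps)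
    qed (simp add: E_def sum_nonneg)
    also have "\<dots> = 0"
      by (simp add: mat_poly_cmat_cvec that cvec_simps)
    finally show "x = 0"
      by (simp add: one_pCons mat_poly_pCons_vector mat_poly_0_vector norm_cvec)
  qed
  thus ?thesis
    using matrix_left_invertible_ker[of "mat_poly p A"] by (simp add: invertible_left_inverse)
qed

lemma span_columns_subset_range:
  fixes A :: "real^'m^'n"
  shows "span (columns A) \<subseteq> range ((*v) A)"
proof (rule span_minimal)
  show "columns A \<subseteq> range ((*v) A)"
    unfolding columns_image_basis by blast
  show "subspace (range ((*v) A))"
    using linear_subspace_image[OF matrix_vector_mul_linear subspace_UNIV] .
qed

text \<open>With \<open>w = q\<^sub>k(L)\<^sup>-\<^sup>1 b\<close>, the Krylov space is spanned by the vectors \<open>L\<^sup>i w\<close> with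
  \<open>i \<le> k\<close>, so \<open>W W\<^sup>T\<close> fixes them.\<close>

lemma krylov_error_le_symmetric:
  fixes L :: "real^'n^'n" and W :: "real^'m^'n"
  assumes sym: "transpose L = L"
    and W: "orthonormal_basis_matrix W (rational_krylov k d L b)"
    and nz: "\<And>\<mu>. complex_of_real \<mu> \<in> numerical_range (cmat L) \<Longrightarrow> poly (pole_poly k d) \<mu> \<noteq> 0"
    and p: "degree p \<le> k"
    and le: "\<And>z. z \<in> numerical_range (cmat L) \<Longrightarrow>
      norm (g z - poly p z / poly (cpoly (pole_poly k d)) z) \<le> E"
  shows "krylov_error g L b W \<le> 2 * norm b * E"
proof -
  define q where "q = pole_poly k d"
  define H where "H = transpose W ** L ** W"
  have iso: "transpose W ** W = mat 1"
    and span: "span (columns W) = rational_krylov k d L b"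
    using W by (auto simp: orthonormal_basis_matrix_def)
  have eigL: "complex_of_real \<mu> \<in> numerical_range (cmat L)" if "\<mu> \<in> eigenvalues L" for \<mu>
    using eigenvalue_compression_in_numerical_range[of "mat 1" \<mu> L] that by (simp add: transpose_mat)
  have eigH: "complex_of_real \<mu> \<in> numerical_range (cmat L)" if "\<mu> \<in> eigenvalues H" for \<mu>
    using eigenvalue_compression_in_numerical_range[OF iso] that by (simp add: H_def)
  have symH: "transpose H = H"
    using sym by (simp add: H_def matrix_transpose_mul matrix_mul_assoc)
  have inv: "invertible (mat_poly q L)"
    using nz eigL by (intro symmetric_mat_poly_invertible[OF sym]) (auto simp: q_def)
  define w where "w = matrix_inv (mat_poly q L) *v b"
  have qw: "mat_poly q L *v w = b"
    using inv by (simp add: w_def matrix_vector_mul_assoc matrix_inv_inverse(1))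
  have fixed_pow: "W *v (transpose W *v (mat_pow L i *v w)) = mat_pow L i *v w" if "i \<le> k" for i
  proof -
    have "mat_poly q L *v (mat_pow L i *v w) = mat_pow L i *v b"
      by (simp add: mat_poly_commute_mat_pow qw)
    hence "matrix_inv (mat_poly q L) *v (mat_pow L i *v b) = mat_pow L i *v w"
      using inv by (metis matrix_inv_inverse(2) matrix_vector_mul_assoc matrix_vector_mul_lid)
    moreover have "mat_pow L i *v b \<in> span ((\<lambda>i. mat_pow L i *v b) ` {..k})"
      using that by (intro span_base) auto
    ultimately have "mat_pow L i *v w \<in> span (columns W)"
      unfolding span rational_krylov_def q_def by (metis imageI)
    then obtain u where "mat_pow L i *v w = W *v u"
      using span_columns_subset_range by blast
    thus ?thesis
      using iso by (metis matrix_vector_mul_assoc matrix_vector_mul_lid)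
  qed
  have fixed: "cmat W *v (cmat (transpose W) *v (mat_poly P (cmat L) *v cvec w)) =
      mat_poly P (cmat L) *v cvec w" if "degree P \<le> k" for P
  proof -
    have "mat_pow (cmat L) i *v cvec w = cvec (mat_pow L i *v w)" for i
      by (induction i) (simp_all add: mat_pow_Suc_vector cmat_mult_cvec, simp add: mat_pow_def)
    thus ?thesis
      using fixed_pow by (simp add: mat_poly_vector[OF that] matrix_vector_mult_sum
          vector_scalar_commute cmat_mult_cvec)
  qed
  define y where "y = cmat (transpose W) *v cvec w"
  have cH: "cmat H = cmat (transpose W) ** cmat L ** cmat W"
    by (simp add: H_def cmat_mult)
  have comp: "mat_poly P (cmat H) *v y = cmat (transpose W) *v (mat_poly P (cmat L) *v cvec w)"
    if "degree P \<le> Suc k" for P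
    unfolding y_def cH using that by (intro mat_poly_compression[OF fixed])
  have qL: "mat_poly (cpoly q) (cmat L) *v cvec w = cvec b"
    by (simp add: mat_poly_cmat_cvec qw)
  \<comment> \<open>With all poles finite the degree is \<open>Suc k\<close>, the last one that
    \<open>comp\<close> admits. Now \<open>y\<close> plays for \<open>H\<close> and
    \<open>W^T b\<close> the role of \<open>w\<close> for \<open>L\<close> and
    \<open>b\<close>.\<close>
  have qH: "mat_poly (cpoly q) (cmat H) *v y = cvec (transpose W *v b)"
    using comp[of "cpoly q"] degree_pole_poly_le[of k d]
    by (simp add: degree_cpoly q_def[symmetric] qL cmat_mult_cvec)
  have pH: "cmat W *v (mat_poly p (cmat H) *v y) = mat_poly p (cmat L) *v cvec w"
    using comp[of p] fixed[of p] p by simp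
  have nzq: "poly (cpoly q) (complex_of_real \<mu>) \<noteq> 0"
    if "complex_of_real \<mu> \<in> numerical_range (cmat L)" for \<mu>
    using nz[OF that] by (simp add: poly_cpoly_of_real q_def)
  note le_q = le[folded q_def]
  let ?eL = "mat_fun g (cmat L) *v cvec b - mat_poly p (cmat L) *v cvec w"
  let ?eH = "mat_fun g (cmat H) *v cvec (transpose W *v b) - mat_poly p (cmat H) *v y"
  have "mat_fun g (cmat L) *v cvec b - krylov_approx g L b W = ?eL - cmat W *v ?eH"
    by (simp add: krylov_approx_def H_def[symmetric] matrix_vector_mult_diff_distrib pH)
  hence "krylov_error g L b W \<le> norm ?eL + norm (cmat W *v ?eH)"
    by (simp only: krylov_error_def norm_triangle_ineq4)
  also have "norm (cmat W *v ?eH) = norm ?eH"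
    by (rule norm_isometry[OF iso])
  also have "norm ?eL \<le> E * norm b"
    unfolding qL[symmetric] norm_cvec[of b, symmetric]
    by (intro mat_fun_minus_rational_norm_le[OF sym] nzq le_q eigL)
  also have "norm ?eH \<le> E * norm (transpose W *v b)"
    unfolding qH[symmetric] norm_cvec[of "transpose W *v b", symmetric]
    by (intro mat_fun_minus_rational_norm_le[OF symH] nzq le_q eigH)
  also have "E * norm (transpose W *v b) \<le> E * norm b"
  proof -
    obtain \<mu> where "\<mu> \<in> eigenvalues L"
      using symmetric_eigenvalues(4)[OF sym] by blast
    hence "0 \<le> E"
      using le[OF eigL] norm_ge_zero order_trans by blast
    thus ?thesis
      using norm_isometry(3)[OF iso] by (intro mult_left_mono)
  qed
  finally show ?thesis by (simp add: mult_ac)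
qed

lemma quasi_optimality_constant_symmetric:
  fixes L :: "real^'n^'n" and W :: "real^'m^'n"
  assumes sym: "transpose L = L"
    and W: "orthonormal_basis_matrix W (rational_krylov k d L b)"
    and nz: "\<And>\<mu>. complex_of_real \<mu> \<in> numerical_range (cmat L) \<Longrightarrow> poly (pole_poly k d) \<mu> \<noteq> 0"
  shows "quasi_optimality_constant k d L b W 1"
  unfolding quasi_optimality_constant_def
proof (intro conjI allI impI)
  fix g \<Sigma> assume \<Sigma>: "g analytic_on numerical_range (cmat L) \<and> numerical_range (cmat L) \<subseteq> \<Sigma>"
  let ?e = "krylov_error g L b W"
  let ?N = "\<lambda>p. sup_norm_on \<Sigma> (\<lambda>z. g z - poly p z / poly (cpoly (pole_poly k d)) z)"
  show "ennreal ?e \<le> ennreal (2 * 1 * norm b) * (INF p\<in>{p. degree p \<le> k}. ?N p)"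
  \<comment> \<open>For \<open>b = 0\<close> the error vanishes. Otherwise the factor
    \<open>2 * norm b\<close> is divided out, so that the infimum can be bounded one
    \<open>p\<close> at a time; an infinite supremum is trivial.\<close>
  proof (cases "b = 0")
    case True
    thus ?thesis by (simp add: krylov_error_def krylov_approx_def cvec_simps)
  next
    case False
    have "ennreal (?e / (2 * norm b)) \<le> (INF p\<in>{p. degree p \<le> k}. ?N p)"
    proof (rule INF_greatest)
      fix p :: "complex poly" assume p: "p \<in> {p. degree p \<le> k}"
      show "ennreal (?e / (2 * norm b)) \<le> ?N p"
      proof (cases "?N p")
        case (real E)
        have "norm (g z - poly p z / poly (cpoly (pole_poly k d)) z) \<le> E"
          if "z \<in> numerical_range (cmat L)" for z
        proof -
          have "ennreal (norm (g z - poly p z / poly (cpoly (pole_poly k d)) z)) \<le> ?N p"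
            unfolding sup_norm_on_def using that \<Sigma> by (intro SUP_upper) auto
          thus ?thesis using real by simp
        qed
        hence "?e \<le> 2 * norm b * E"
          using p by (intro krylov_error_le_symmetric[OF sym W nz]) auto
        thus ?thesis
          using real False by (simp add: field_simps ennreal_leI)
      qed simp
    qed
    hence "ennreal (2 * norm b) * ennreal (?e / (2 * norm b)) \<le>
        ennreal (2 * norm b) * (INF p\<in>{p. degree p \<le> k}. ?N p)"
      by (rule mult_left_mono) simp
    also have "ennreal (2 * norm b) * ennreal (?e / (2 * norm b)) = ennreal ?e"
      using False by (subst ennreal_mult[symmetric]) (auto simp: krylov_error_def)
    finally show ?thesis by simp
  qed
qed simp

section \<open>Best rational approximation\<close>

text \<open>The coefficients are reversed with respect to \<open>k\<close>, not to the degree of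
  \<open>p\<close>. Numerator and denominator thus acquire the same factor \<open>z ^ k\<close>,
  which cancels in their quotient.\<close>

lemma poly_reciprocal_substitution:
  fixes p :: "'a::field poly"
  assumes "degree p \<le> k"
  obtains p' where "degree p' \<le> k" "\<And>z. z \<noteq> 0 \<Longrightarrow> poly p' z = z ^ k * poly p (l / z)"
proof
  let ?p = "\<Sum>i\<le>k. monom (coeff p i * l ^ i) (k - i)"
  show "degree ?p \<le> k"
    by (intro degree_sum_le) (auto intro: order.trans[OF degree_monom_le])
  fix z :: 'a assume "z \<noteq> 0"
  have "poly p (l / z) = (\<Sum>i\<le>k. coeff p i * (l / z) ^ i)"
    using assms by (subst poly_altdef) (intro sum.mono_neutral_left, auto simp: not_le coeff_eq_0)
  thus "poly ?p z = z ^ k * poly p (l / z)"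
    using \<open>z \<noteq> 0\<close>
    by (auto simp: poly_sum poly_monom sum_distrib_left power_divide power_diff intro!: sum.cong)
qed

lemma best_rational_approx_neg_powr_le:
  assumes stahl: "stahl_constant s C" and "0 < l"
    and best: "best_rational_approx k (\<lambda>z. z powr (- s)) {l..u} p q"
  shows "sup_norm_on {l..u} (\<lambda>z. z powr (- s) - poly p z / poly q z)
    \<le> ennreal (C * l powr (- s) * exp (- 2 * pi * sqrt (real k * s)))"
proof -
  define e where "e = C * exp (- 2 * pi * sqrt (real k * s))"
  have "0 < C" using stahl by (simp add: stahl_constant_def)
  obtain p0 q0 where r0: "rational_on k {0..1} p0 q0"
    and e: "sup_norm_on {0..1} (\<lambda>z. z powr s - poly p0 z / poly q0 z) \<le> ennreal e"
    using stahl unfolding stahl_constant_def best_rational_approx_def e_def by blast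
  have le_e: "\<bar>x powr s - poly p0 x / poly q0 x\<bar> \<le> e" if "x \<in> {0..1}" for x
  proof -
    have "ennreal (norm (x powr s - poly p0 x / poly q0 x)) \<le>
        sup_norm_on {0..1} (\<lambda>z. z powr s - poly p0 z / poly q0 z)"
      unfolding sup_norm_on_def using that by (intro SUP_upper)
    also note e
    finally show ?thesis
      using \<open>0 < C\<close> by (simp add: e_def)
  qed
  obtain p1 where p1: "degree p1 \<le> k" "\<And>z. z \<noteq> 0 \<Longrightarrow> poly p1 z = z ^ k * poly p0 (l / z)"
    using poly_reciprocal_substitution r0 unfolding rational_on_def by metis
  obtain q1 where q1: "degree q1 \<le> k" "\<And>z. z \<noteq> 0 \<Longrightarrow> poly q1 z = z ^ k * poly q0 (l / z)"
    using poly_reciprocal_substitution r0 unfolding rational_on_def by metis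
  \<comment> \<open>The factor comes from
    \<open>z powr (- s) = l powr (- s) * (l / z) powr s\<close>. For \<open>z\<close> in
    \<open>{l..u}\<close> the point \<open>l / z\<close> lies in \<open>{0..1}\<close>, where
    \<open>q0\<close> has no zero.\<close>
  define p2 where "p2 = smult (l powr (- s)) p1"
  have "rational_on k {l..u} p2 q1"
    using p1 q1 r0 \<open>0 < l\<close> by (auto simp: rational_on_def p2_def)
  hence "sup_norm_on {l..u} (\<lambda>z. z powr (- s) - poly p z / poly q z)
      \<le> sup_norm_on {l..u} (\<lambda>z. z powr (- s) - poly p2 z / poly q1 z)"
    using best by (simp add: best_rational_approx_def)
  also have "\<dots> \<le> ennreal (l powr (- s) * e)"
    unfolding sup_norm_on_def
  proof (intro SUP_least ennreal_leI)
    fix z assume z: "z \<in> {l..u}"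
    have "z powr (- s) = l powr (- s) * (l / z) powr s"
      using z \<open>0 < l\<close> by (simp add: powr_minus powr_divide field_simps)
    moreover have "poly p2 z / poly q1 z = l powr (- s) * (poly p0 (l / z) / poly q0 (l / z))"
      using z \<open>0 < l\<close> by (simp add: p2_def p1 q1)
    ultimately have "norm (z powr (- s) - poly p2 z / poly q1 z) =
        l powr (- s) * \<bar>(l / z) powr s - poly p0 (l / z) / poly q0 (l / z)\<bar>"
      by (simp add: right_diff_distrib[symmetric] abs_mult del: times_divide_eq_right)
    also have "\<dots> \<le> l powr (- s) * e"
      using z \<open>0 < l\<close> by (intro mult_left_mono le_e) auto
    finally show "norm (z powr (- s) - poly p2 z / poly q1 z) \<le> l powr (- s) * e" .
  qed
  finally show ?thesis by (simp add: e_def mult_ac)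
qed

text \<open>Where the denominator is nonzero the quotient has a finite limit. The converse can fail,
  since a common zero may be removable.\<close>

lemma rational_pole_imp_root:
  assumes "z \<in> rational_poles p q"
  shows "poly (cpoly q) z = 0"
proof (rule ccontr)
  let ?f = "\<lambda>w. poly (cpoly p) w / poly (cpoly q) w"
  assume "poly (cpoly q) z \<noteq> 0"
  hence "(?f \<longlongrightarrow> ?f z) (at z)"
    by (intro tendsto_intros) auto
  moreover have "filterlim ?f at_infinity (at z)"
    using assms by (simp add: rational_poles_def is_pole_def)
  ultimately show False
    using not_tendsto_and_filterlim_at_infinity[of "at z" ?f] by simp
qed

lemma prod_linear_factors_dvd:
  fixes q :: "'a::field poly"
  assumes "finite A" "\<And>x. x \<in> A \<Longrightarrow> poly q x = 0"
  shows "(\<Prod>x\<in>A. [:- x, 1:]) dvd q"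
  using assms
proof (induction A)
  case (insert a A)
  then obtain r where r: "q = (\<Prod>x\<in>A. [:- x, 1:]) * r"
    by (auto elim: dvdE)
  have "poly q a = 0"
    using insert.prems by simp
  hence "poly r a = 0"
    using insert.hyps by (auto simp: r poly_prod)
  hence "[:- a, 1:] dvd r"
    by (simp add: poly_eq_0_iff_dvd)
  thus ?case
    unfolding r prod.insert[OF insert.hyps] by (subst mult.commute) (rule mult_dvd_mono[OF dvd_refl])
qed simp

lemma denominator_eq_smult_pole_poly:
  assumes q: "degree q \<le> k" "q \<noteq> 0"
    and d: "d 0 = -\<infinity>" "\<forall>j\<in>{1..k}. d j \<noteq> -\<infinity> \<and> d j \<le> 0" "inj_on d {1..k}"
    and poles: "rational_poles p q = (\<lambda>j. complex_of_real (real_of_ereal (d j))) ` {1..k}"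
  obtains c where "c \<noteq> 0" "q = smult c (pole_poly k d)"
proof -
  \<comment> \<open>The pole at infinity contributes no factor, so \<open>pole_poly k d\<close> has
    degree exactly \<open>k\<close>. As \<open>q\<close> has degree at most \<open>k\<close>, the
    cofactor found below is constant.\<close>
  have "{j. j \<le> k \<and> d j \<noteq> -\<infinity>} = {1..k}"
    using d by (auto simp: Suc_le_eq intro!: gr0I)
  hence P: "pole_poly k d = (\<Prod>j\<in>{1..k}. [:- real_of_ereal (d j), 1:])"
    by (simp add: pole_poly_def)
  \<comment> \<open>Distinct extended reals remain distinct here because all of them are finite:
    neither minus infinity nor positive.\<close>
  have inj: "inj_on (\<lambda>j. real_of_ereal (d j)) {1..k}"
  proof (rule inj_onI)
    fix i j assume ij: "i \<in> {1..k}" "j \<in> {1..k}" "real_of_ereal (d i) = real_of_ereal (d j)"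
    have "\<bar>d i\<bar> \<noteq> \<infinity>" "\<bar>d j\<bar> \<noteq> \<infinity>"
      using d(2) ij(1,2) by fastforce+
    hence "d i = d j"
      using ij(3) by (metis ereal_real')
    thus "i = j" using d(3) ij by (auto dest: inj_onD)
  qed
  have "poly q x = 0" if "x \<in> (\<lambda>j. real_of_ereal (d j)) ` {1..k}" for x
  proof -
    have "complex_of_real x \<in> rational_poles p q"
      using that poles by auto
    from rational_pole_imp_root[OF this] show ?thesis
      by (simp add: poly_cpoly_of_real)
  qed
  hence "(\<Prod>x\<in>(\<lambda>j. real_of_ereal (d j)) ` {1..k}. [:- x, 1:]) dvd q"
    by (intro prod_linear_factors_dvd) auto
  hence "pole_poly k d dvd q"
    unfolding prod.reindex[OF inj] o_def P .
  then obtain r where r: "q = pole_poly k d * r" by (elim dvdE)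
  have "degree (pole_poly k d) = k"
    by (simp add: P degree_prod_eq_sum_degree)
  hence "degree r = 0"
    using q r by (auto simp: degree_mult_eq)
  then obtain c where "r = [:c:]" by (rule degree_eq_zeroE)
  thus ?thesis
    using that[of c] q r by (auto simp: mult.commute)
qed

theorem mainTheorem4:
  fixes K M L :: "real^'n^'n" and b :: "real^'n" and W :: "real^'m^'n"
    and s Cs lam1 lamn :: real and k :: nat and d :: "nat \<Rightarrow> ereal" and p q :: "real poly"
  assumes "pos_def K" and "pos_def M" and "L = matrix_inv M ** K"
    and "lam1 = Min (eigenvalues L)" and "lamn = Max (eigenvalues L)"
    and "numerical_range (cmat L) \<subseteq> complex_of_real ` {lam1..lamn}"
    and "0 < s" and "s < 1"
    and "stahl_constant s Cs"
    and "best_rational_approx k (\<lambda>z. z powr (- s)) {lam1..lamn} p q"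
    and "d 0 = -\<infinity>"
    and "\<forall>j\<in>{1..k}. d j \<noteq> -\<infinity> \<and> d j \<le> 0" and "inj_on d {1..k}"
    and "rational_poles p q = (\<lambda>j. complex_of_real (real_of_ereal (d j))) ` {1..k}"
    and "CARD('m) = k + 1"
    and "orthonormal_basis_matrix W (rational_krylov k d L b)"
  shows "(\<exists>C. quasi_optimality_constant k d L b W C \<and> C \<le> 11.08 \<and> (transpose L = L \<longrightarrow> C = 1)) \<and>
    (\<forall>C. quasi_optimality_constant k d L b W C \<longrightarrow>
      krylov_error (\<lambda>z. z powr (- complex_of_real s)) L b W
        \<le> 2 * C * Cs * lam1 powr (- s) * exp (- 2 * pi * sqrt (real k * s)) * norm b)"
proof -
  have sym: "transpose L = L"
    using assms(6) by (intro symmetric_if_numerical_range_real) auto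
  note eigs = symmetric_eigenvalues(3,4)[OF sym]
  have "lam1 \<in> eigenvalues L"
    using eigs assms(4) by simp
  hence lam1: "0 < lam1"
    using pos_def_pencil_eigenvalue_pos assms(1-3) by blast
  have "lam1 \<le> lamn"
    using eigs assms(4,5) by simp
  have best: "degree p \<le> k" "degree q \<le> k" "\<And>z. z \<in> {lam1..lamn} \<Longrightarrow> poly q z \<noteq> 0"
    using assms(10) by (auto simp: best_rational_approx_def rational_on_def)
  have "q \<noteq> 0"
    using best(3)[of lam1] \<open>lam1 \<le> lamn\<close> by auto
  then obtain c where c: "c \<noteq> 0" "q = smult c (pole_poly k d)"
    using denominator_eq_smult_pole_poly best(2) assms(11-14) by metis
  have nz: "poly (pole_poly k d) x \<noteq> 0" if "x \<in> {lam1..lamn}" for x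
    using best(3)[OF that] c by simp
  have "quasi_optimality_constant k d L b W 1"
    using assms(6) nz by (intro quasi_optimality_constant_symmetric[OF sym assms(16)]) auto
  moreover have "krylov_error (\<lambda>z. z powr (- complex_of_real s)) L b W
      \<le> 2 * C * Cs * lam1 powr (- s) * exp (- 2 * pi * sqrt (real k * s)) * norm b"
    if C: "quasi_optimality_constant k d L b W C" for C
  proof -
    let ?g = "\<lambda>z. z powr (- complex_of_real s)"
    let ?\<Sigma> = "complex_of_real ` {lam1..lamn}"
    let ?E = "Cs * lam1 powr (- s) * exp (- 2 * pi * sqrt (real k * s))"
    let ?N = "\<lambda>p. sup_norm_on ?\<Sigma> (\<lambda>z. ?g z - poly p z / poly (cpoly (pole_poly k d)) z)"
    have "0 \<le> C" using C by (simp add: quasi_optimality_constant_def)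
    have "0 < Cs" using assms(9) by (simp add: stahl_constant_def)
    \<comment> \<open>Positivity of \<open>lam1\<close> keeps the interval off the branch cut of the
      complex power.\<close>
    have "?g analytic_on numerical_range (cmat L)"
      using assms(6) lam1 by (intro analytic_intros) auto
    hence err: "ennreal (krylov_error ?g L b W)
        \<le> ennreal (2 * C * norm b) * (INF p\<in>{p. degree p \<le> k}. ?N p)"
      using C assms(6) unfolding quasi_optimality_constant_def by blast
    have INF_le: "(INF p\<in>{p. degree p \<le> k}. ?N p) \<le> ennreal ?E"
    proof -
      \<comment> \<open>Since \<open>q\<close> is \<open>c\<close> times
        \<open>pole_poly k d\<close>, dividing the numerator by \<open>c\<close> writes the best
        approximation with the Krylov denominator.\<close>
      have "(INF p\<in>{p. degree p \<le> k}. ?N p) \<le> ?N (cpoly (smult (1 / c) p))"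
        using best(1) by (intro INF_lower) (simp add: degree_cpoly del: smult_conv_map_poly)
      also have "\<dots> = sup_norm_on {lam1..lamn} (\<lambda>z. z powr (- s) - poly p z / poly q z)"
      proof -
        have "norm (?g (complex_of_real x) - poly (cpoly (smult (1 / c) p)) (complex_of_real x) /
              poly (cpoly (pole_poly k d)) (complex_of_real x))
            = norm (x powr (- s) - poly p x / poly q x)" if "x \<in> {lam1..lamn}" for x
        proof -
          have "?g (complex_of_real x) = complex_of_real (x powr (- s))"
            using that lam1 powr_of_real[of x "- s"] by simp
          moreover have "poly (smult (1 / c) p) x / poly (pole_poly k d) x = poly p x / poly q x"
            by (simp add: c)
          ultimately have "?g (complex_of_real x) -
              poly (cpoly (smult (1 / c) p)) (complex_of_real x) /
                poly (cpoly (pole_poly k d)) (complex_of_real x)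
              = complex_of_real (x powr (- s) - poly p x / poly q x)"
            unfolding poly_cpoly_of_real by (metis of_real_diff of_real_divide)
          thus ?thesis by (simp only: norm_of_real real_norm_def)
        qed
        thus ?thesis
          unfolding sup_norm_on_def image_image by (intro SUP_cong) auto
      qed
      also have "\<dots> \<le> ennreal ?E"
        by (rule best_rational_approx_neg_powr_le[OF assms(9) lam1 assms(10)])
      finally show ?thesis .
    qed
    note err
    also have "ennreal (2 * C * norm b) * (INF p\<in>{p. degree p \<le> k}. ?N p)
        \<le> ennreal (2 * C * norm b) * ennreal ?E"
      by (intro mult_left_mono INF_le) simp
    also have "ennreal (2 * C * norm b) * ennreal ?E = ennreal (2 * C * norm b * ?E)"
      using \<open>0 \<le> C\<close> \<open>0 < Cs\<close> by (intro ennreal_mult[symmetric]) auto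
    finally have "krylov_error ?g L b W \<le> 2 * C * norm b * ?E"
      using \<open>0 \<le> C\<close> \<open>0 < Cs\<close> by (subst (asm) ennreal_le_iff) (auto intro!: mult_nonneg_nonneg)
    thus ?thesis by (simp add: mult_ac)
  qed
  ultimately show ?thesis
    by (intro conjI exI[of _ 1]) auto
qed

end
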